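(* Let $a\in\mathbb R^{V\times L}$ be a coefficient vector and consider the linear program in the variable $\varphi\in\mathcal F$ (viewed as a vector in $\mathbb R^{V\times L}$): \[ \max_\varphi\ \sum_{i\in V}\sum_{\tau\in L}a_i(\tau)\varphi_i(\tau) \] subject to \[ \varphi_i(u_i)\le p\,g_i(u_i)+\sum_{j\in N(i)}\Big(\tfrac{p}{2}h_{ij}(u_i,u_j)+q\,w_{ji}\,\varphi_j(u_j)\Big)\qquad\forall i\in V,\ \forall u\in L^V. \] If $a$ is non-negative (every entry $\ge 0$), the fixed point $\bar\varphi$ of $T$ is an optimal solution of this LP. If $a$ is positive (every entry $>0$), $\bar\varphi$ is the unique optimal solution of this LP.
   Context: Let $G=(V,E)$ be an undirected, simple, connected graph with $V=\{1,\dots,n\}$, $n\ge 2$. For $i\in V$ let $N(i)=\{j\in V:\{i,j\}\in E\}$. Let $L$ be a finite set of labels. For each $i\in V$ let $g_i:L\to[0,\infty)$, and for each $\{i,j\}\in E$ let $h_{ij},h_{ji}:L^2\to[0,\infty)$ with $h_{ij}(a,b)=h_{ji}(b,a)$. Fix $p\in(0,1)$, $q=1-p$, and weights $w_{ij}\in[0,1]$ for $i\in V$, $j\in N(i)$, with $\sum_{j\in N(i)}w_{ij}=1$ for every $i\in V$. Let $\mathcal{F}$ be the set of tuples $\varphi=(\varphi_1,\dots,\varphi_n)$ with $\varphi_i:L\to\mathbb{R}$. The map $T:\mathcal F\to\mathcal F$ is defined by \[ (T\varphi)_i(\tau)=p\,g_i(\tau)+\sum_{j\in N(i)}\min_{u_j\in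 L}\Big(\tfrac{p}{2}h_{ij}(\tau,u_j)+q\,w_{ji}\,\varphi_j(u_j)\Big), \] and $\bar\varphi$ denotes its unique fixed point. *)

theory Defs
  imports "HOL-Analysis.Analysis"
begin

text \<open>
  The vertex set is the universe of a finite type \<open>'v\<close> and the label set is the universe of a
  finite (hence nonempty) type \<open>'l\<close>. A tuple of functions is an element of
  \<open>'v \<Rightarrow> 'l \<Rightarrow> real\<close>, so equality of tuples is equality of all their entries.
\<close>

definition simple_graph :: "'v set set \<Rightarrow> bool" where
  "simple_graph E \<longleftrightarrow> (\<forall>e\<in>E. card e = 2)"

definition connected_graph :: "'v set set \<Rightarrow> bool" where
  "connected_graph E \<longleftrightarrow> (\<forall>i j. (i, j) \<in> {(x, y). {x, y} \<in> E}\<^sup>*)"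

definition nbrs :: "'v set set \<Rightarrow> 'v \<Rightarrow> 'v set" where
  "nbrs E i = {j. {i, j} \<in> E}"

definition T_map ::
  "'v::finite set set \<Rightarrow> ('v \<Rightarrow> 'l::finite \<Rightarrow> real) \<Rightarrow> ('v \<Rightarrow> 'v \<Rightarrow> 'l \<Rightarrow> 'l \<Rightarrow> real) \<Rightarrow>
   ('v \<Rightarrow> 'v \<Rightarrow> real) \<Rightarrow> real \<Rightarrow> real \<Rightarrow> ('v \<Rightarrow> 'l \<Rightarrow> real) \<Rightarrow> ('v \<Rightarrow> 'l \<Rightarrow> real)" where
  "T_map E g h w p q \<phi> = (\<lambda>i \<tau>. p * g i \<tau> +
     (\<Sum>j\<in>nbrs E i. MIN u. (p / 2 * h i j \<tau> u + q * w j i * \<phi> j u)))"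

text \<open>
  The description operator is only meaningful once existence and uniqueness of the fixed point
  are established: under the standing assumptions, \<open>T_map\<close> is a contraction with factor \<open>q\<close>
  for the norm \<open>\<Sum>i. Max\<^sub>\<tau> \<bar>\<phi> i \<tau>\<bar>\<close>.
\<close>

definition phi_bar ::
  "'v::finite set set \<Rightarrow> ('v \<Rightarrow> 'l::finite \<Rightarrow> real) \<Rightarrow> ('v \<Rightarrow> 'v \<Rightarrow> 'l \<Rightarrow> 'l \<Rightarrow> real) \<Rightarrow>
   ('v \<Rightarrow> 'v \<Rightarrow> real) \<Rightarrow> real \<Rightarrow> real \<Rightarrow> ('v \<Rightarrow> 'l \<Rightarrow> real)" where
  "phi_bar E g h w p q = (THE \<phi>. T_map E g h w p q \<phi> = \<phi>)"

definition lp_objective :: "('v::finite \<Rightarrow> 'l::finite \<Rightarrow> real) \<Rightarrow> ('v \<Rightarrow> 'l \<Rightarrow> real) \<Rightarrow> real" where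
  "lp_objective a \<phi> = (\<Sum>i\<in>UNIV. \<Sum>\<tau>\<in>UNIV. a i \<tau> * \<phi> i \<tau>)"

definition lp_feasible ::
  "'v::finite set set \<Rightarrow> ('v \<Rightarrow> 'l::finite \<Rightarrow> real) \<Rightarrow> ('v \<Rightarrow> 'v \<Rightarrow> 'l \<Rightarrow> 'l \<Rightarrow> real) \<Rightarrow>
   ('v \<Rightarrow> 'v \<Rightarrow> real) \<Rightarrow> real \<Rightarrow> real \<Rightarrow> ('v \<Rightarrow> 'l \<Rightarrow> real) set" where
  "lp_feasible E g h w p q = {\<phi>. \<forall>i. \<forall>u :: 'v \<Rightarrow> 'l.
     \<phi> i (u i) \<le> p * g i (u i) +
       (\<Sum>j\<in>nbrs E i. p / 2 * h i j (u i) (u j) + q * w j i * \<phi> j (u j))}"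

definition lp_optimal ::
  "'v::finite set set \<Rightarrow> ('v \<Rightarrow> 'l::finite \<Rightarrow> real) \<Rightarrow> ('v \<Rightarrow> 'v \<Rightarrow> 'l \<Rightarrow> 'l \<Rightarrow> real) \<Rightarrow>
   ('v \<Rightarrow> 'v \<Rightarrow> real) \<Rightarrow> real \<Rightarrow> real \<Rightarrow> ('v \<Rightarrow> 'l \<Rightarrow> real) \<Rightarrow> ('v \<Rightarrow> 'l \<Rightarrow> real) \<Rightarrow> bool" where
  "lp_optimal E g h w p q a \<phi> \<longleftrightarrow> \<phi> \<in> lp_feasible E g h w p q \<and>
     (\<forall>\<psi>\<in>lp_feasible E g h w p q. lp_objective a \<psi> \<le> lp_objective a \<phi>)"

end

theory Submission
  imports Defs
begin

text \<open>
  A tuple is feasible iff it is a sub-solution \<open>\<phi> \<le> T \<phi>\<close>: minimise each summand separately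
  (possible because no vertex is its own neighbour). If \<open>\<psi> \<le> T \<psi>\<close> and \<open>T \<phi> \<le> \<phi> + b\<close>, the
  positive excesses \<open>d i = max\<^sub>\<tau> (\<psi> i \<tau> - \<phi> i \<tau>)\<^sup>+\<close> satisfy \<open>d i \<le> b + q \<Sum>j. w j i * d j\<close>;
  summing over \<open>i\<close> and using that the weights leaving each vertex add up to 1 bounds \<open>\<Sum>i. d i\<close> by
  \<open>n b / p\<close>. For \<open>\<phi> = 0\<close> this bounds all sub-solutions, so by the Knaster--Tarski argument their
  pointwise supremum is a fixed point; for \<open>b = 0\<close> it shows that every fixed point dominates every
  sub-solution. Hence the fixed point is unique and is the greatest feasible tuple.
\<close>

text \<open>Evaluating the left-hand minimum at a minimiser \<open>v\<close> of the right-hand one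
  suffices. As \<open>d\<close> does not depend on the label, it leaves the minimum as the constant
  \<open>k * d\<close>.\<close>

lemma Min_affine_le:
  fixes c x y :: "'l::finite \<Rightarrow> real"
  assumes "k \<ge> 0" and "\<And>u. x u \<le> y u + d"
  shows "(MIN u. c u + k * x u) \<le> (MIN u. c u + k * y u) + k * d"
proof -
  have "(MIN u. c u + k * y u) \<in> range (\<lambda>u. c u + k * y u)"
    by (rule Min_in) auto
  then obtain v where v: "(MIN u. c u + k * y u) = c v + k * y v" by blast
  have "(MIN u. c u + k * x u) \<le> c v + k * x v" by (rule Min_le) auto
  also have "\<dots> \<le> c v + k * (y v + d)" using assms by (simp add: mult_left_mono)
  finally show ?thesis by (simp add: v algebra_simps)
qed

lemma mem_nbrs_sym: "j \<in> nbrs E i \<longleftrightarrow> i \<in> nbrs E j"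
  by (simp add: nbrs_def insert_commute)

lemma not_mem_nbrs_self: "simple_graph E \<Longrightarrow> i \<notin> nbrs E i"
  by (auto simp: simple_graph_def nbrs_def)

lemma lp_feasible_iff_le_T_map:
  assumes "simple_graph E"
  shows "\<phi> \<in> lp_feasible E g h w p q \<longleftrightarrow> \<phi> \<le> T_map E g h w p q \<phi>"
proof
  assume feas: "\<phi> \<in> lp_feasible E g h w p q"
  show "\<phi> \<le> T_map E g h w p q \<phi>"
  proof (intro le_funI)
    fix i \<tau>
    let ?f = "\<lambda>j v. p / 2 * h i j \<tau> v + q * w j i * \<phi> j v"
    have "\<exists>v. (MIN v. ?f j v) = ?f j v" for j
    proof -
      have "(MIN v. ?f j v) \<in> range (?f j)" by (rule Min_in) auto
      then show ?thesis by blast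
    qed
    then obtain m where m: "\<And>j. (MIN v. ?f j v) = ?f j (m j)" by metis
    \<comment> \<open>A single labelling attains all the minima at once: \<open>m\<close> picks a
      minimiser for each neighbour, and resetting its value at \<open>i\<close> to
      \<open>\<tau>\<close> disturbs no summand, since \<open>i\<close> is not a neighbour of
      itself.\<close>
    have "\<phi> i ((m(i := \<tau>)) i) \<le> p * g i ((m(i := \<tau>)) i) +
       (\<Sum>j\<in>nbrs E i. p / 2 * h i j ((m(i := \<tau>)) i) ((m(i := \<tau>)) j)
          + q * w j i * \<phi> j ((m(i := \<tau>)) j))"
      using feas unfolding lp_feasible_def by blast
    also have "\<dots> = p * g i \<tau> + (\<Sum>j\<in>nbrs E i. ?f j (m j))"
      using not_mem_nbrs_self[OF assms] by (auto intro!: sum.cong)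
    finally show "\<phi> i \<tau> \<le> T_map E g h w p q \<phi> i \<tau>"
      by (simp only: T_map_def m fun_upd_same)
  qed
next
  assume le: "\<phi> \<le> T_map E g h w p q \<phi>"
  show "\<phi> \<in> lp_feasible E g h w p q"
    unfolding lp_feasible_def
  proof (intro CollectI allI)
    fix i and u :: "'a \<Rightarrow> 'b"
    have "\<phi> i (u i) \<le> T_map E g h w p q \<phi> i (u i)" using le by (simp add: le_fun_def)
    also have "\<dots> \<le> p * g i (u i) +
        (\<Sum>j\<in>nbrs E i. p / 2 * h i j (u i) (u j) + q * w j i * \<phi> j (u j))"
      unfolding T_map_def by (intro add_left_mono sum_mono Min_le) auto
    finally show "\<phi> i (u i) \<le> p * g i (u i) +
        (\<Sum>j\<in>nbrs E i. p / 2 * h i j (u i) (u j) + q * w j i * \<phi> j (u j))" .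
  qed
qed

lemma lp_objective_mono:
  assumes "\<forall>i \<tau>. a i \<tau> \<ge> 0" and "\<psi> \<le> \<phi>"
  shows "lp_objective a \<psi> \<le> lp_objective a \<phi>"
  unfolding lp_objective_def using assms
  by (intro sum_mono mult_left_mono) (auto simp: le_fun_def)

lemma lp_objective_strict_mono:
  assumes "\<forall>i \<tau>. a i \<tau> > 0" and le: "\<psi> \<le> \<phi>" and "\<psi> \<noteq> \<phi>"
  shows "lp_objective a \<psi> < lp_objective a \<phi>"
proof -
  obtain i \<tau> where neq: "\<psi> i \<tau> \<noteq> \<phi> i \<tau>" using \<open>\<psi> \<noteq> \<phi>\<close> by (meson ext)
  have le': "a j t * \<psi> j t \<le> a j t * \<phi> j t" for j t
    using assms(1) le by (simp add: le_fun_def)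
  have "\<psi> i \<tau> < \<phi> i \<tau>" using neq le by (simp add: le_fun_def less_le)
  then have "(\<Sum>t\<in>UNIV. a i t * \<psi> i t) < (\<Sum>t\<in>UNIV. a i t * \<phi> i t)"
    using assms(1) le' by (intro sum_strict_mono_ex1) auto
  then show ?thesis
    unfolding lp_objective_def using le'
    by (intro sum_strict_mono_ex1) (auto intro: sum_mono)
qed

locale weighted_labelling =
  fixes E :: "'v::finite set set"
    and g :: "'v \<Rightarrow> 'l::finite \<Rightarrow> real"
    and h :: "'v \<Rightarrow> 'v \<Rightarrow> 'l \<Rightarrow> 'l \<Rightarrow> real"
    and w :: "'v \<Rightarrow> 'v \<Rightarrow> real"
    and p q :: real
  assumes g_nonneg: "g i \<tau> \<ge> 0"
    and h_nonneg: "{i, j} \<in> E \<Longrightarrow> h i j s t \<ge> 0"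
    and p_pos: "0 < p" and p_less_1: "p < 1" and q_eq: "q = 1 - p"
    and w_nonneg: "j \<in> nbrs E i \<Longrightarrow> 0 \<le> w i j"
    and sum_w: "(\<Sum>j\<in>nbrs E i. w i j) = 1"
begin

abbreviation T where "T \<equiv> T_map E g h w p q"

lemma q_nonneg: "q \<ge> 0"
  using p_less_1 q_eq by simp

text \<open>A one-sided Lipschitz estimate that keeps a separate bound \<open>d j\<close> for each
  vertex. Taking \<open>d = 0\<close> gives monotonicity; taking \<open>d\<close> to be the excesses
  gives the inequality that is later summed over all vertices.\<close>

lemma T_map_le_add:
  assumes "\<And>j u. \<psi> j u \<le> \<phi> j u + d j"
  shows "T \<psi> i \<tau> \<le> T \<phi> i \<tau> + (\<Sum>j\<in>nbrs E i. q * w j i * d j)"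
proof -
  have "(\<Sum>j\<in>nbrs E i. MIN u. p / 2 * h i j \<tau> u + q * w j i * \<psi> j u)
      \<le> (\<Sum>j\<in>nbrs E i. (MIN u. p / 2 * h i j \<tau> u + q * w j i * \<phi> j u) + q * w j i * d j)"
    \<comment> \<open>The weight in the sum at \<open>i\<close> is \<open>w j i\<close>, so its sign
      comes from \<open>i\<close> being a neighbour of \<open>j\<close>.\<close>
    using assms q_nonneg w_nonneg mem_nbrs_sym[of _ E i]
    by (intro sum_mono Min_affine_le mult_nonneg_nonneg) auto
  then show ?thesis by (simp add: T_map_def sum.distrib)
qed

lemma T_map_mono: "\<psi> \<le> \<phi> \<Longrightarrow> T \<psi> \<le> T \<phi>"
  using T_map_le_add[of \<psi> \<phi> "\<lambda>_. 0"] by (simp add: le_fun_def)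

lemma T_map_0_nonneg: "0 \<le> T (\<lambda>_ _. 0) i \<tau>"
proof -
  have "0 \<le> (MIN u. p / 2 * h i j \<tau> u)" if "j \<in> nbrs E i" for j
    using that h_nonneg p_pos by (subst Min_ge_iff) (auto simp: nbrs_def)
  then show ?thesis
    using g_nonneg p_pos by (auto simp: T_map_def intro!: add_nonneg_nonneg sum_nonneg)
qed

text \<open>Double counting over ordered adjacent pairs: after the swap, \<open>d j\<close> is
  multiplied by the total weight leaving \<open>j\<close>, which is 1. The weights entering a vertex
  may add up to more than 1, hence a sum over vertices rather than a maximum.\<close>

lemma sum_weighted_nbrs: "(\<Sum>i\<in>UNIV. \<Sum>j\<in>nbrs E i. q * w j i * d j) = q * (\<Sum>j\<in>UNIV. d j)"
proof -
  have "(\<Sum>i\<in>UNIV. \<Sum>j\<in>nbrs E i. q * w j i * d j)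
      = (\<Sum>i\<in>UNIV. \<Sum>j | j \<in> UNIV \<and> j \<in> nbrs E i. q * w j i * d j)" by simp
  also have "\<dots> = (\<Sum>j\<in>UNIV. \<Sum>i | i \<in> UNIV \<and> j \<in> nbrs E i. q * w j i * d j)"
    by (rule sum.swap_restrict) auto
  also have "\<dots> = (\<Sum>j\<in>UNIV. \<Sum>i\<in>nbrs E j. q * w j i * d j)"
    by (intro sum.cong) (auto simp: mem_nbrs_sym)
  also have "\<dots> = (\<Sum>j\<in>UNIV. q * d j * (\<Sum>i\<in>nbrs E j. w j i))"
    by (simp add: sum_distrib_left mult_ac)
  finally show ?thesis by (simp add: sum_w sum_distrib_left)
qed

lemma sub_solution_le:
  fixes b :: real
  assumes sub: "\<psi> \<le> T \<psi>" and super: "\<And>i \<tau>. T \<phi> i \<tau> \<le> \<phi> i \<tau> + b" and "b \<ge> 0"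
  shows "\<psi> i \<tau> \<le> \<phi> i \<tau> + CARD('v) * b / p"
proof -
  \<comment> \<open>Truncation at 0 makes every \<open>d j\<close> nonnegative, so that a single
    excess is bounded by the sum of all of them.\<close>
  define d where "d j = (MAX u. max 0 (\<psi> j u - \<phi> j u))" for j
  have d_ge: "max 0 (\<psi> j u - \<phi> j u) \<le> d j" for j u
    unfolding d_def by (rule Max_ge) auto
  have d_nonneg: "0 \<le> d j" for j
    using d_ge[of j undefined] by simp
  have excess: "\<psi> j u \<le> \<phi> j u + d j" for j u
    using d_ge[of j u] by simp
  have d_le: "d j \<le> b + (\<Sum>k\<in>nbrs E j. q * w k j * d k)" (is "_ \<le> ?R") for j
  proof -
    have "0 \<le> ?R"
      using \<open>b \<ge> 0\<close> d_nonneg q_nonneg w_nonneg mem_nbrs_sym[of _ E j]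
      by (auto intro!: add_nonneg_nonneg sum_nonneg mult_nonneg_nonneg)
    moreover have "\<psi> j u - \<phi> j u \<le> ?R" for u
    proof -
      have "\<psi> j u \<le> T \<psi> j u" using sub by (simp add: le_fun_def)
      with T_map_le_add[of \<psi> \<phi> d j u, OF excess] super[of j u] show ?thesis by linarith
    qed
    ultimately show ?thesis
      unfolding d_def[of j] by (subst Max_le_iff) auto
  qed
  have "(\<Sum>j\<in>UNIV. d j) \<le> (\<Sum>j\<in>UNIV. b + (\<Sum>k\<in>nbrs E j. q * w k j * d k))"
    by (intro sum_mono d_le)
  also have "\<dots> = CARD('v) * b + q * (\<Sum>j\<in>UNIV. d j)"
    by (simp add: sum.distrib sum_weighted_nbrs)
  \<comment> \<open>The total excess occurs on both sides; moving its \<open>q\<close>-fold to the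
    left leaves the factor \<open>1 - q = p\<close>.\<close>
  finally have "(\<Sum>j\<in>UNIV. d j) \<le> CARD('v) * b / p"
    using p_pos by (simp add: q_eq field_simps)
  moreover have "d i \<le> (\<Sum>j\<in>UNIV. d j)"
    by (rule member_le_sum) (auto simp: d_nonneg)
  ultimately show ?thesis using excess[of i \<tau>] by linarith
qed

lemma sub_solution_le_super_solution:
  assumes "\<psi> \<le> T \<psi>" and "T \<phi> \<le> \<phi>"
  shows "\<psi> \<le> \<phi>"
  using sub_solution_le[of \<psi> \<phi> 0] assms by (simp add: le_fun_def)

lemma ex_fixed_point: "\<exists>\<phi>. T \<phi> = \<phi>"
proof -
  define S where "S = {\<psi>. \<psi> \<le> T \<psi>}"
  define \<phi> where "\<phi> i \<tau> = (SUP \<psi>\<in>S. \<psi> i \<tau>)" for i \<tau>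
  \<comment> \<open>A crude common bound for the entries of \<open>T 0\<close>: they are
    nonnegative, so their sum dominates each one. It makes the real suprema in \<open>\<phi>\<close>
    bounded.\<close>
  define b where "b = (\<Sum>i\<in>UNIV. \<Sum>\<tau>\<in>UNIV. T (\<lambda>_ _. 0) i \<tau>)"
  have "T (\<lambda>_ _. 0) i \<tau> \<le> b" for i \<tau>
  proof -
    have "T (\<lambda>_ _. 0) i \<tau> \<le> (\<Sum>\<tau>\<in>UNIV. T (\<lambda>_ _. 0) i \<tau>)"
      by (rule member_le_sum) (auto simp: T_map_0_nonneg)
    also have "\<dots> \<le> b" unfolding b_def
      by (rule member_le_sum[where f = "\<lambda>i. \<Sum>\<tau>\<in>UNIV. T (\<lambda>_ _. 0) i \<tau>"])
        (auto simp: T_map_0_nonneg sum_nonneg)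
    finally show ?thesis .
  qed
  moreover have "b \<ge> 0" by (simp add: b_def T_map_0_nonneg sum_nonneg)
  ultimately have "\<psi> i \<tau> \<le> CARD('v) * b / p" if "\<psi> \<in> S" for \<psi> i \<tau>
    using sub_solution_le[of \<psi> "\<lambda>_ _. 0" b i \<tau>] that by (simp add: S_def)
  then have bdd: "bdd_above ((\<lambda>\<psi>. \<psi> i \<tau>) ` S)" for i \<tau>
    by (intro bdd_aboveI2)
  have ub: "\<psi> \<le> \<phi>" if "\<psi> \<in> S" for \<psi>
    unfolding \<phi>_def using that by (auto intro!: le_funI cSUP_upper bdd)
  have "(\<lambda>_ _. 0) \<in> S" by (simp add: S_def le_fun_def T_map_0_nonneg)
  then have "S \<noteq> {}" by blast
  have sub: "\<phi> \<le> T \<phi>"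
  proof (intro le_funI)
    fix i \<tau>
    show "\<phi> i \<tau> \<le> T \<phi> i \<tau>"
      unfolding \<phi>_def[of i \<tau>]
    proof (rule cSUP_least[OF \<open>S \<noteq> {}\<close>])
      fix \<psi> assume "\<psi> \<in> S"
      then have "\<psi> \<le> T \<psi>" by (simp add: S_def)
      also have "T \<psi> \<le> T \<phi>" using \<open>\<psi> \<in> S\<close> by (intro T_map_mono ub)
      finally show "\<psi> i \<tau> \<le> T \<phi> i \<tau>" by (simp add: le_fun_def)
    qed
  qed
  \<comment> \<open>Applying the monotone \<open>T\<close> to \<open>\<phi> \<le> T \<phi>\<close>
    makes \<open>T \<phi>\<close> itself a sub-solution, hence at most the supremum
    \<open>\<phi>\<close>.\<close>
  then have "T \<phi> \<in> S" by (simp add: S_def T_map_mono)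
  then have "T \<phi> \<le> \<phi>" by (rule ub)
  then have "T \<phi> = \<phi>" using sub by (rule antisym)
  then show ?thesis by blast
qed

text \<open>Justifies the description operator in \<open>phi_bar\<close>. Of two fixed points, each
  is both a sub- and a super-solution, so each lies below the other.\<close>

lemma T_map_phi_bar: "T (phi_bar E g h w p q) = phi_bar E g h w p q"
proof -
  have "\<phi> = \<psi>" if "T \<phi> = \<phi>" and "T \<psi> = \<psi>" for \<phi> \<psi>
    using that sub_solution_le_super_solution[of \<phi> \<psi>] sub_solution_le_super_solution[of \<psi> \<phi>]
    by simp
  then have "\<exists>!\<phi>. T \<phi> = \<phi>" using ex_fixed_point by blast
  then show ?thesis unfolding phi_bar_def by (rule theI')
qed

lemma sub_solution_le_phi_bar: "\<psi> \<le> T \<psi> \<Longrightarrow> \<psi> \<le> phi_bar E g h w p q"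
  by (rule sub_solution_le_super_solution) (simp_all add: T_map_phi_bar)

end

theorem theorem3:
  fixes E :: "'v::finite set set"
    and g :: "'v \<Rightarrow> 'l::finite \<Rightarrow> real"
    and h :: "'v \<Rightarrow> 'v \<Rightarrow> 'l \<Rightarrow> 'l \<Rightarrow> real"
    and w :: "'v \<Rightarrow> 'v \<Rightarrow> real"
    and p q :: real
    and a :: "'v \<Rightarrow> 'l \<Rightarrow> real"
  assumes "CARD('v) \<ge> 2"
    and "simple_graph E"
    and "connected_graph E"
    and "\<And>i \<tau>. g i \<tau> \<ge> 0"
    and "\<And>i j s t. {i, j} \<in> E \<Longrightarrow> h i j s t \<ge> 0"
    and "\<And>i j s t. {i, j} \<in> E \<Longrightarrow> h i j s t = h j i t s"
    and "0 < p" and "p < 1" and "q = 1 - p"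
    and "\<And>i j. j \<in> nbrs E i \<Longrightarrow> 0 \<le> w i j \<and> w i j \<le> 1"
    and "\<And>i. (\<Sum>j\<in>nbrs E i. w i j) = 1"
  shows "((\<forall>i \<tau>. a i \<tau> \<ge> 0) \<longrightarrow> lp_optimal E g h w p q a (phi_bar E g h w p q)) \<and>
    ((\<forall>i \<tau>. a i \<tau> > 0) \<longrightarrow>
       lp_optimal E g h w p q a (phi_bar E g h w p q) \<and>
       (\<forall>\<psi>. lp_optimal E g h w p q a \<psi> \<longrightarrow> \<psi> = phi_bar E g h w p q))"
proof -
  interpret weighted_labelling E g h w p q
    by unfold_locales (use assms in auto)
  let ?\<phi> = "phi_bar E g h w p q" and ?F = "lp_feasible E g h w p q"
  have feasible: "?\<phi> \<in> ?F"
    by (simp add: lp_feasible_iff_le_T_map[OF \<open>simple_graph E\<close>] T_map_phi_bar)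
  have greatest: "\<psi> \<le> ?\<phi>" if "\<psi> \<in> ?F" for \<psi>
    using that by (simp add: lp_feasible_iff_le_T_map[OF \<open>simple_graph E\<close>] sub_solution_le_phi_bar)
  have optimal: "lp_optimal E g h w p q a ?\<phi>" if "\<forall>i \<tau>. a i \<tau> \<ge> 0"
    using that by (simp add: lp_optimal_def feasible greatest lp_objective_mono)
  have unique: "\<psi> = ?\<phi>" if "\<forall>i \<tau>. a i \<tau> > 0" and "lp_optimal E g h w p q a \<psi>" for \<psi>
  proof (rule ccontr)
    \<comment> \<open>A second optimum would lie below the greatest feasible tuple and differ from
      it in some entry; a positive coefficient there makes its objective strictly smaller.\<close>
    assume "\<psi> \<noteq> ?\<phi>"
    with that have "lp_objective a \<psi> < lp_objective a ?\<phi>"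
      by (intro lp_objective_strict_mono greatest) (auto simp: lp_optimal_def)
    moreover have "lp_objective a ?\<phi> \<le> lp_objective a \<psi>"
      using that(2) feasible by (simp add: lp_optimal_def)
    ultimately show False by simp
  qed
  show ?thesis using optimal unique by (simp add: less_imp_le)
qed

end
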